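(* (i) The class (II, II) of generalized triplets has $D_1,D_2$ even and both not divisible by $3$, and consists of the triplets of odd primes $$p_i=3(2a-1)-D_1,\quad p_m=3(2a-1)+D_1=3(2b-1)-D_2,\quad p_f=3(2b-1)+D_2$$ with integers $a,b$, so that $3(b-a)=\frac12(D_1+D_2)$. Therefore $3\mid D_1+D_2$ and $D_1\equiv -D_2\pmod 3$. Moreover $p_f=p_i+2(D_1+D_2)=3(2a-1)+D_1+2D_2$, and the prime pair consisting of $p_f=3(2a-1)+D_2+(D_1+D_2)$ and $p_i=3(2a-1)+D_2-(D_1+D_2)$ is in class III, with $6\mid D_1+D_2$. (ii) If $D_i\equiv 2r_i\pmod 6$ with $r_i\in\{1,-1\}$ for $i=1,2$, then $$p_i\equiv -3-2r_1,\quad p_m\equiv -3+2r_1\equiv -3-2r_2,\quad p_f\equiv -3+2r_2\equiv p_i\pmod 6.$$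
   Context: A generalized triplet is a triple of odd primes $p_i<p_m<p_f$ with $p_m-p_i=2D_1$, $p_f-p_m=2D_2$. For a pair of odd primes $p<p'$ with $p'-p=2D$, the classes are, with $a$ an integer: class I: $D$ odd, $p=2a-D$, $p'=2a+D$; class II: $2\mid D$, $3\nmid D$, $p=3(2a-1)-D$, $p'=3(2a-1)+D$; class III: $6\mid D$, $D\ge 6$, $p=2a+1-D$, $p'=2a+1+D$. A triplet is in class $(X,Y)$ if $(p_i,p_m)$ is in class $X$ and $(p_m,p_f)$ is in class $Y$. *)

theory Defs
  imports Complex_Main "HOL-Number_Theory.Cong"
begin

text \<open>
  Primes are taken in \<^typ>\<open>int\<close> (where \<^const>\<open>prime\<close> implies positivity), because the
  parameters \<open>a\<close>, \<open>b\<close> of the classes range over all integers.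
\<close>

definition odd_prime :: "int \<Rightarrow> bool" where
  "odd_prime p \<longleftrightarrow> prime p \<and> odd p"

definition generalized_triplet :: "int \<Rightarrow> int \<Rightarrow> int \<Rightarrow> bool" where
  "generalized_triplet p_i p_m p_f \<longleftrightarrow>
     odd_prime p_i \<and> odd_prime p_m \<and> odd_prime p_f \<and> p_i < p_m \<and> p_m < p_f \<and>
     (\<exists>D1 D2. p_m - p_i = 2 * D1 \<and> p_f - p_m = 2 * D2)"

datatype pair_class = Class_I | Class_II | Class_III

fun class_form :: "pair_class \<Rightarrow> int \<Rightarrow> int \<Rightarrow> int \<Rightarrow> bool" where
  "class_form Class_I D p p' \<longleftrightarrow>
     odd D \<and> (\<exists>a. p = 2 * a - D \<and> p' = 2 * a + D)"
| "class_form Class_II D p p' \<longleftrightarrow>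
     2 dvd D \<and> \<not> 3 dvd D \<and> (\<exists>a. p = 3 * (2 * a - 1) - D \<and> p' = 3 * (2 * a - 1) + D)"
| "class_form Class_III D p p' \<longleftrightarrow>
     6 dvd D \<and> D \<ge> 6 \<and> (\<exists>a. p = 2 * a + 1 - D \<and> p' = 2 * a + 1 + D)"

definition pair_in_class :: "pair_class \<Rightarrow> int \<Rightarrow> int \<Rightarrow> bool" where
  "pair_in_class X p p' \<longleftrightarrow>
     odd_prime p \<and> odd_prime p' \<and> p < p' \<and> (\<exists>D. p' - p = 2 * D \<and> class_form X D p p')"

definition triplet_class :: "pair_class \<Rightarrow> pair_class \<Rightarrow> (int \<times> int \<times> int) set" where
  "triplet_class X Y = {(p_i, p_m, p_f).
     generalized_triplet p_i p_m p_f \<and> pair_in_class X p_i p_m \<and> pair_in_class Y p_m p_f}"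

end

theory Submission
  imports Defs
begin

text \<open>The middle prime of a (II, II) triplet is described twice, as 3(2a-1) + D1 by the lower
  pair and as 3(2b-1) - D2 by the upper pair. Equating the two gives D1 + D2 = 6(b-a)
  (\<open>class_II_II_tripletE\<close>), which carries all of (i): the outer primes differ by 2(D1 +
  D2), so their half-difference is a multiple of 6, and this together with oddness and order puts
  them in class III (\<open>pair_in_class_III\<close>). For (ii), 3(2a-1) and 3(2b-1) are both -3
  modulo 6, so each prime is -3 plus or minus a half-difference. The two forms of p_m link r1 with
  r2, and p_f agrees with p_i because D1 + D2 vanishes modulo 6.\<close>

text \<open>The half-difference is determined by the pair, so the existential witness in
  \<open>pair_in_class\<close> must be the given \<open>D\<close>.\<close>

lemma class_II_pairE:
  assumes "pair_in_class Class_II p p'" "p' - p = 2 * D"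
  obtains a where "even D" "\<not> 3 dvd D" "p = 3 * (2 * a - 1) - D" "p' = 3 * (2 * a - 1) + D"
proof -
  from assms(1) obtain D' where D': "p' - p = 2 * D'" "class_form Class_II D' p p'"
    by (auto simp: pair_in_class_def)
  then have "D' = D"
    using assms(2) by simp
  with D'(2) that show thesis
    by auto
qed

lemma class_II_II_tripletE:
  assumes "(p_i, p_m, p_f) \<in> triplet_class Class_II Class_II"
    and "p_m - p_i = 2 * D1" "p_f - p_m = 2 * D2"
  obtains a b where "even D1" "even D2" "\<not> 3 dvd D1" "\<not> 3 dvd D2"
    "p_i = 3 * (2 * a - 1) - D1" "p_m = 3 * (2 * a - 1) + D1"
    "p_m = 3 * (2 * b - 1) - D2" "p_f = 3 * (2 * b - 1) + D2" "D1 + D2 = 6 * (b - a)"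
proof -
  from assms(1) have "pair_in_class Class_II p_i p_m" "pair_in_class Class_II p_m p_f"
    by (auto simp: triplet_class_def)
  from class_II_pairE[OF this(1) assms(2)] class_II_pairE[OF this(2) assms(3)]
  obtain a b where
    "even D1" "\<not> 3 dvd D1" "p_i = 3 * (2 * a - 1) - D1" "p_m = 3 * (2 * a - 1) + D1"
    "even D2" "\<not> 3 dvd D2" "p_m = 3 * (2 * b - 1) - D2" "p_f = 3 * (2 * b - 1) + D2"
    by metis
  moreover from this have "D1 + D2 = 6 * (b - a)"
    by (simp add: algebra_simps)
  ultimately show thesis
    using that by blast
qed

text \<open>The half-differences are existential on the right. Going forward they come from
  \<open>generalized_triplet\<close>; going back they are recovered by subtracting the two
  expressions of each pair.\<close>

lemma triplet_class_II_II_iff: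
  "(p_i, p_m, p_f) \<in> triplet_class Class_II Class_II \<longleftrightarrow>
     odd_prime p_i \<and> odd_prime p_m \<and> odd_prime p_f \<and> p_i < p_m \<and> p_m < p_f \<and>
     (\<exists>D1 D2 a b. even D1 \<and> even D2 \<and> \<not> 3 dvd D1 \<and> \<not> 3 dvd D2 \<and>
        p_i = 3 * (2 * a - 1) - D1 \<and>
        p_m = 3 * (2 * a - 1) + D1 \<and> p_m = 3 * (2 * b - 1) - D2 \<and>
        p_f = 3 * (2 * b - 1) + D2)"
  (is "?L \<longleftrightarrow> ?O \<and> ?O' \<and> ?O'' \<and> ?lt \<and> ?lt' \<and> ?E")
proof
  assume L: ?L
  then have gt: "generalized_triplet p_i p_m p_f"
    by (simp add: triplet_class_def)
  then obtain D1 D2 where "p_m - p_i = 2 * D1" "p_f - p_m = 2 * D2"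
    by (auto simp: generalized_triplet_def)
  from class_II_II_tripletE[OF L this] have ?E
    by metis
  with gt show "?O \<and> ?O' \<and> ?O'' \<and> ?lt \<and> ?lt' \<and> ?E"
    by (simp add: generalized_triplet_def)
next
  assume R: "?O \<and> ?O' \<and> ?O'' \<and> ?lt \<and> ?lt' \<and> ?E"
  then obtain D1 D2 a b where D: "even D1" "even D2" "\<not> 3 dvd D1" "\<not> 3 dvd D2"
    and p: "p_i = 3 * (2 * a - 1) - D1" "p_m = 3 * (2 * a - 1) + D1"
      "p_m = 3 * (2 * b - 1) - D2" "p_f = 3 * (2 * b - 1) + D2"
    by blast
  have diff: "p_m - p_i = 2 * D1" "p_f - p_m = 2 * D2"
    using p by linarith+
  have "class_form Class_II D1 p_i p_m" "class_form Class_II D2 p_m p_f"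
    unfolding class_form.simps using D p by blast+
  then have "pair_in_class Class_II p_i p_m" "pair_in_class Class_II p_m p_f"
    using R diff by (auto simp only: pair_in_class_def)
  then show ?L
    using R diff by (auto simp: triplet_class_def generalized_triplet_def)
qed

text \<open>For ordered odd primes, divisibility of the half-difference by 6 already forces the
  whole shape of class III: the bound follows from the order and the odd midpoint from
  parity.\<close>

lemma pair_in_class_III:
  assumes "odd_prime p" "odd_prime p'" "p < p'" "p' = p + 2 * D" "6 dvd D"
  shows "pair_in_class Class_III p p'"
proof -
  obtain k where "D = 6 * k"
    using assms(5) by (rule dvdE)
  \<comment> \<open>Since \<open>p < p'\<close>, the multiple \<open>D\<close> of 6 is
    positive.\<close>
  then have "6 \<le> D"
    using assms(3,4) by presburger
  \<comment> \<open>The class parameter is read off the midpoint \<open>p + D\<close>, which is odd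
    because \<open>p\<close> is odd and \<open>D\<close> is even.\<close>
  obtain c where "p + D = 2 * c + 1"
    using assms(1) \<open>D = 6 * k\<close> unfolding odd_prime_def by (metis oddE dvd_add_left_iff dvd_triv_left even_mult_iff even_numeral)
  then have "p = 2 * c + 1 - D" "p' = 2 * c + 1 + D"
    using assms(4) by linarith+
  then have "class_form Class_III D p p'"
    using assms(5) \<open>6 \<le> D\<close> by auto
  moreover have "p' - p = 2 * D"
    using assms(4) by simp
  ultimately show ?thesis
    using assms(1-3) unfolding pair_in_class_def by blast
qed

theorem corollary2p7:
  shows
    "triplet_class Class_II Class_II =
       {(p_i, p_m, p_f). odd_prime p_i \<and> odd_prime p_m \<and> odd_prime p_f \<and> p_i < p_m \<and> p_m < p_f \<and>
          (\<exists>D1 D2 a b. even D1 \<and> even D2 \<and> \<not> 3 dvd D1 \<and> \<not> 3 dvd D2 \<and>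
             p_i = 3 * (2 * a - 1) - D1 \<and>
             p_m = 3 * (2 * a - 1) + D1 \<and> p_m = 3 * (2 * b - 1) - D2 \<and>
             p_f = 3 * (2 * b - 1) + D2)}
     \<and> (\<forall>p_i p_m p_f D1 D2 :: int.
          (p_i, p_m, p_f) \<in> triplet_class Class_II Class_II \<longrightarrow>
          p_m - p_i = 2 * D1 \<longrightarrow> p_f - p_m = 2 * D2 \<longrightarrow>
            even D1 \<and> even D2 \<and> \<not> 3 dvd D1 \<and> \<not> 3 dvd D2
          \<and> (\<exists>a b. p_i = 3 * (2 * a - 1) - D1 \<and>
               p_m = 3 * (2 * a - 1) + D1 \<and> p_m = 3 * (2 * b - 1) - D2 \<and>
               p_f = 3 * (2 * b - 1) + D2)
          \<and> (\<forall>a b. p_i = 3 * (2 * a - 1) - D1 \<longrightarrow>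
               p_m = 3 * (2 * a - 1) + D1 \<longrightarrow> p_m = 3 * (2 * b - 1) - D2 \<longrightarrow>
               p_f = 3 * (2 * b - 1) + D2 \<longrightarrow>
                 of_int (3 * (b - a)) = (1 / 2 :: rat) * of_int (D1 + D2)
               \<and> p_f = 3 * (2 * a - 1) + D1 + 2 * D2
               \<and> p_f = 3 * (2 * a - 1) + D2 + (D1 + D2)
               \<and> p_i = 3 * (2 * a - 1) + D2 - (D1 + D2))
          \<and> 3 dvd D1 + D2 \<and> [D1 = - D2] (mod 3)
          \<and> p_f = p_i + 2 * (D1 + D2)
          \<and> pair_in_class Class_III p_i p_f \<and> 6 dvd D1 + D2)
     \<and> (\<forall>p_i p_m p_f D1 D2 r1 r2 :: int.
          (p_i, p_m, p_f) \<in> triplet_class Class_II Class_II \<longrightarrow>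
          p_m - p_i = 2 * D1 \<longrightarrow> p_f - p_m = 2 * D2 \<longrightarrow>
          r1 \<in> {1, -1} \<longrightarrow> r2 \<in> {1, -1} \<longrightarrow>
          [D1 = 2 * r1] (mod 6) \<longrightarrow> [D2 = 2 * r2] (mod 6) \<longrightarrow>
            [p_i = -3 - 2 * r1] (mod 6)
          \<and> [p_m = -3 + 2 * r1] (mod 6) \<and> [-3 + 2 * r1 = -3 - 2 * r2] (mod 6)
          \<and> [p_f = -3 + 2 * r2] (mod 6) \<and> [-3 + 2 * r2 = p_i] (mod 6))"
proof (intro conjI allI impI)
  show "triplet_class Class_II Class_II =
       {(p_i, p_m, p_f). odd_prime p_i \<and> odd_prime p_m \<and> odd_prime p_f \<and> p_i < p_m \<and> p_m < p_f \<and>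
          (\<exists>D1 D2 a b. even D1 \<and> even D2 \<and> \<not> 3 dvd D1 \<and> \<not> 3 dvd D2 \<and>
             p_i = 3 * (2 * a - 1) - D1 \<and>
             p_m = 3 * (2 * a - 1) + D1 \<and> p_m = 3 * (2 * b - 1) - D2 \<and>
             p_f = 3 * (2 * b - 1) + D2)}"
    by (rule set_eqI) (simp only: split_paired_all mem_Collect_eq case_prod_conv triplet_class_II_II_iff)
next
  fix p_i p_m p_f D1 D2 :: int
  assume T: "(p_i, p_m, p_f) \<in> triplet_class Class_II Class_II"
    and diff: "p_m - p_i = 2 * D1" "p_f - p_m = 2 * D2"
  obtain a b where D: "even D1" "even D2" "\<not> 3 dvd D1" "\<not> 3 dvd D2"
    and p: "p_i = 3 * (2 * a - 1) - D1" "p_m = 3 * (2 * a - 1) + D1"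
      "p_m = 3 * (2 * b - 1) - D2" "p_f = 3 * (2 * b - 1) + D2"
    and sum: "D1 + D2 = 6 * (b - a)"
    using class_II_II_tripletE[OF T diff] .
  show "even D1" "even D2" "\<not> 3 dvd D1" "\<not> 3 dvd D2"
    by (fact D)+
  show "\<exists>a b. p_i = 3 * (2 * a - 1) - D1 \<and>
          p_m = 3 * (2 * a - 1) + D1 \<and> p_m = 3 * (2 * b - 1) - D2 \<and>
          p_f = 3 * (2 * b - 1) + D2"
    using p by blast
  show six: "6 dvd D1 + D2"
    using sum by simp
  then show three: "3 dvd D1 + D2"
    by presburger
  then show "[D1 = - D2] (mod 3)"
    by (simp add: cong_iff_dvd_diff)
  show pf: "p_f = p_i + 2 * (D1 + D2)"
    using diff by (simp add: algebra_simps)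
  \<comment> \<open>The outer pair has half-difference \<open>D1 + D2\<close>, a multiple of 6 by
    \<open>six\<close>.\<close>
  show "pair_in_class Class_III p_i p_f"
    using T pf six by (intro pair_in_class_III[where D = "D1 + D2"])
      (auto simp: triplet_class_def generalized_triplet_def)
next
  fix p_i p_m p_f D1 D2 a b :: int
  assume p: "p_i = 3 * (2 * a - 1) - D1" "p_m = 3 * (2 * a - 1) + D1"
      "p_m = 3 * (2 * b - 1) - D2" "p_f = 3 * (2 * b - 1) + D2"
  \<comment> \<open>Here \<open>a\<close> and \<open>b\<close> are arbitrary parameters satisfying
    the four equations, so the relation is derived anew from the two forms of \<open>p_m\<close>;
    the factor 2 is split off to match the rational 1/2.\<close>
  have "D1 + D2 = 2 * (3 * (b - a))"
    using p by (simp add: algebra_simps)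
  then show "of_int (3 * (b - a)) = (1 / 2 :: rat) * of_int (D1 + D2)"
    by simp
  show "p_f = 3 * (2 * a - 1) + D1 + 2 * D2"
    "p_f = 3 * (2 * a - 1) + D2 + (D1 + D2)"
    "p_i = 3 * (2 * a - 1) + D2 - (D1 + D2)"
    using p by linarith+
next
  fix p_i p_m p_f D1 D2 r1 r2 :: int
  assume T: "(p_i, p_m, p_f) \<in> triplet_class Class_II Class_II"
    and diff: "p_m - p_i = 2 * D1" "p_f - p_m = 2 * D2"
    and r: "[D1 = 2 * r1] (mod 6)" "[D2 = 2 * r2] (mod 6)"
  obtain a b where p: "p_i = 3 * (2 * a - 1) - D1" "p_m = 3 * (2 * a - 1) + D1"
      "p_m = 3 * (2 * b - 1) - D2" "p_f = 3 * (2 * b - 1) + D2"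
    using class_II_II_tripletE[OF T diff] .
  \<comment> \<open>With explicit multiples of 6 in place of the congruences, each claim becomes
    divisibility by 6 of a linear expression, within reach of Presburger arithmetic.\<close>
  obtain k l where "D1 = 2 * r1 + 6 * k" "D2 = 2 * r2 + 6 * l"
    using r by (metis cong_iff_lin cong_sym)
  note eqs = p this
  show "[p_i = -3 - 2 * r1] (mod 6)" "[p_m = -3 + 2 * r1] (mod 6)"
    "[-3 + 2 * r1 = -3 - 2 * r2] (mod 6)" "[p_f = -3 + 2 * r2] (mod 6)"
    "[-3 + 2 * r2 = p_i] (mod 6)"
    unfolding cong_iff_dvd_diff using eqs by presburger+
qed

end
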